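(* Let $X\neq\emptyset$ be a set, $f:X\to X$ a self-map, and equip $X$ with the primal topology $\tau_f$ induced by $f$. For $x\in X$ let $V(x)$ be the smallest open set containing $x$. The following statements are equivalent: (i) $f$ is topologically ergodic. (ii) $f(X)=X$ and, for all $x,y\in X$, $V(x)\subseteq V(y)$ or $V(y)\subseteq V(x)$. (iii) $X=\mathcal{O}(x)\cup\hat{x}(\mathbb{N})$ for some $x\in X$ and some infinite preorbit $\hat{x}$ of $x$.
   Context: $\mathbb{N}$ is the set of non-negative integers. The primal topology induced by $f$ on $X$ is $\tau_f=\{A\subseteq X: f^{-1}(A)\subseteq A\}$; it is closed under arbitrary intersections, and $V(x)=\{y\in X:\exists k\in\mathbb{N},\ f^k(y)=x\}$. The map $f$ is topologically ergodic if $D(U,V)=\{k\in\mathbb{N}: f^k(U)\cap V\neq\emptyset\}$ is infinite for every pair of non-empty open sets $U,V$. The orbit of $x$ is $\mathcal{O}(x)=\{f^k(x):k\in\mathbb{N}\}$. An infinite preorbit of $x$ is a function $\hat{x}:\mathbb{N}\to X$ with $\hat{x}(0)=x$ and $f(\hat{x}(k))=\hat{x}(k-1)$ for all $k\ge 1$. *)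

theory Defs
  imports "HOL-Analysis.Abstract_Topology"
begin

definition primal_topology :: "'a set \<Rightarrow> ('a \<Rightarrow> 'a) \<Rightarrow> 'a topology" where
  "primal_topology X f = topology (\<lambda>A. A \<subseteq> X \<and> f -` A \<inter> X \<subseteq> A)"

lemma istopology_primal: "istopology (\<lambda>A. A \<subseteq> X \<and> f -` A \<inter> X \<subseteq> A)"
  unfolding istopology_def by blast

lemma openin_primal_topology:
  "openin (primal_topology X f) A \<longleftrightarrow> A \<subseteq> X \<and> f -` A \<inter> X \<subseteq> A"
  unfolding primal_topology_def by (simp add: topology_inverse' istopology_primal)

lemma topspace_primal_topology: "topspace (primal_topology X f) = X"
  unfolding topspace_def openin_primal_topology by blast

definition smallest_open :: "'a topology \<Rightarrow> 'a \<Rightarrow> 'a set" where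
  "smallest_open T x = (LEAST U. openin T U \<and> x \<in> U)"

(* For a self-map the smallest open set exists, so the LEAST above is well-defined. *)
lemma smallest_open_primal_topology:
  assumes "f \<in> X \<rightarrow> X" and "x \<in> X"
  shows "smallest_open (primal_topology X f) x = {y \<in> X. \<exists>k. (f ^^ k) y = x}"
proof -
  let ?V = "{y \<in> X. \<exists>k. (f ^^ k) y = x}"
  have "x \<in> ?V"
    using assms(2) by (auto intro: exI[of _ 0])
  moreover have "f -` ?V \<inter> X \<subseteq> ?V"
  proof
    fix y assume "y \<in> f -` ?V \<inter> X"
    then obtain k where "y \<in> X" "(f ^^ k) (f y) = x" by auto
    then have "(f ^^ Suc k) y = x" by (simp add: funpow_swap1)
    with \<open>y \<in> X\<close> show "y \<in> ?V" by blast
  qed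
  moreover have "?V \<subseteq> U" if U: "f -` U \<inter> X \<subseteq> U" "x \<in> U" for U
  proof -
    have "y \<in> U" if "y \<in> X" "(f ^^ k) y = x" for y k
      using that
    proof (induction k arbitrary: y)
      case 0
      then show ?case using U(2) by simp
    next
      case (Suc k)
      then have "f y \<in> U" using assms(1) by (simp add: funpow_swap1 Pi_iff)
      then show ?case using U(1) Suc.prems(1) by blast
    qed
    then show ?thesis by blast
  qed
  ultimately show ?thesis
    unfolding smallest_open_def openin_primal_topology
    by (intro Least_equality) auto
qed

definition topologically_ergodic :: "'a topology \<Rightarrow> ('a \<Rightarrow> 'a) \<Rightarrow> bool" where
  "topologically_ergodic T f \<longleftrightarrow>
    (\<forall>U V. openin T U \<and> U \<noteq> {} \<and> openin T V \<and> V \<noteq> {} \<longrightarrow>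
      infinite {k::nat. (f ^^ k) ` U \<inter> V \<noteq> {}})"

definition forward_orbit :: "('a \<Rightarrow> 'a) \<Rightarrow> 'a \<Rightarrow> 'a set" where
  "forward_orbit f x = {(f ^^ k) x | k::nat. True}"

definition infinite_preorbit :: "'a set \<Rightarrow> ('a \<Rightarrow> 'a) \<Rightarrow> 'a \<Rightarrow> (nat \<Rightarrow> 'a) \<Rightarrow> bool" where
  "infinite_preorbit X f x h \<longleftrightarrow>
    range h \<subseteq> X \<and> h 0 = x \<and> (\<forall>k\<ge>1. f (h k) = h (k - 1))"

end

theory Submission imports Defs begin

text \<open>
  The inclusion \<open>V x \<subseteq> V y\<close> means that \<open>y\<close> lies on the orbit of \<open>x\<close>, so (ii) says
  that \<open>f\<close> is onto and any two points are comparable for the orbit preorder.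
  Ergodicity applied to \<open>V x\<close> and \<open>V y\<close> yields a point whose orbit passes through both,
  and a positive return time of \<open>V x\<close> yields a preimage of \<open>x\<close>; conversely, backward
  iteration through a surjection makes transition times arbitrarily large.
  For (iii), if every point is periodic then \<open>X\<close> is a single cycle. Otherwise any preorbit
  \<open>h\<close> of a non-periodic point \<open>x\<close> works: if \<open>f\<^sup>k y = x\<close>, then \<open>y\<close> and \<open>h k\<close> are comparable and
  reach \<open>x\<close> in the same time, so they coincide, as otherwise \<open>x\<close> would be periodic.
\<close>

section \<open>Iterates, smallest open sets and preorbits\<close>

lemma funpow_mem:
  assumes "f \<in> X \<rightarrow> X" "x \<in> X"
  shows "(f ^^ n) x \<in> X"
  using assms by (induction n) auto

text \<open>The points \<open>x\<close> and \<open>y\<close> lie on the orbit of \<open>u\<close>,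
  so the one visited later is an iterate of the one visited earlier.\<close>

lemma funpow_orbit_chain:
  assumes "(f ^^ a) u = x" "(f ^^ b) u = y"
  shows "(\<exists>k. (f ^^ k) x = y) \<or> (\<exists>k. (f ^^ k) y = x)"
proof -
  have "(f ^^ (b - a)) x = y" if "a \<le> b"
    using assms that by (metis comp_apply funpow_add le_add_diff_inverse2)
  moreover have "(f ^^ (a - b)) y = x" if "b \<le> a"
    using assms that by (metis comp_apply funpow_add le_add_diff_inverse2)
  ultimately show ?thesis
    using nat_le_linear by blast
qed

text \<open>Translates (ii) into the orbit preorder: \<open>x\<close> lies in its own smallest open
  set, and iterates compose.\<close>

lemma smallest_open_subset_iff:
  assumes "f \<in> X \<rightarrow> X" "x \<in> X" "y \<in> X"
  shows "smallest_open (primal_topology X f) x \<subseteq> smallest_open (primal_topology X f) y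
    \<longleftrightarrow> (\<exists>k. (f ^^ k) x = y)"
proof
  assume "smallest_open (primal_topology X f) x \<subseteq> smallest_open (primal_topology X f) y"
  moreover have "x \<in> smallest_open (primal_topology X f) x"
    using assms by (auto simp: smallest_open_primal_topology intro: exI[of _ 0])
  ultimately show "\<exists>k. (f ^^ k) x = y"
    using assms by (auto simp: smallest_open_primal_topology)
next
  assume "\<exists>k. (f ^^ k) x = y"
  then obtain k where k: "(f ^^ k) x = y" by blast
  have "\<exists>j. (f ^^ j) z = y" if "(f ^^ i) z = x" for z i
    using k that by (intro exI[of _ "k + i"]) (simp add: funpow_add)
  then show "smallest_open (primal_topology X f) x \<subseteq> smallest_open (primal_topology X f) y"
    using assms by (auto simp: smallest_open_primal_topology)
qed

lemma openin_primal_topology_funpow: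
  assumes "openin (primal_topology X f) U" "f \<in> X \<rightarrow> X" "x \<in> X" "(f ^^ k) x \<in> U"
  shows "x \<in> U"
  using assms(3,4)
proof (induction k arbitrary: x)
  case (Suc k)
  then have "f x \<in> U" using assms(2) by (auto simp: funpow_swap1)
  then show ?case using assms(1) Suc.prems(1) by (auto simp: openin_primal_topology)
qed simp

lemma openin_primal_topology_backward:
  assumes "f \<in> X \<rightarrow> X" "x \<in> X"
  shows "openin (primal_topology X f) {y \<in> X. \<exists>k. (f ^^ k) y = x}"
  using assms
  by (auto simp: openin_primal_topology) (metis funpow_swap1 o_apply funpow.simps(2))

text \<open>Iterating a right inverse of \<open>f\<close> from \<open>x\<close> works; surjectivity
  keeps its values in \<open>X\<close>.\<close>

lemma infinite_preorbit_exists: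
  assumes "f ` X = X" "x \<in> X"
  shows "\<exists>h. infinite_preorbit X f x h"
proof -
  define h where "h n = (inv_into X f ^^ n) x" for n
  have mem: "h n \<in> X" for n
    using assms by (induction n) (auto simp: h_def inv_into_into)
  have "f (h (Suc n)) = h n" for n
    using mem[of n] assms(1) by (simp add: h_def f_inv_into_f)
  then have "f (h k) = h (k - 1)" if "k \<ge> 1" for k
    using that by (cases k) auto
  moreover have "h 0 = x" by (simp add: h_def)
  ultimately show ?thesis
    using mem by (intro exI[of _ h]) (auto simp: infinite_preorbit_def)
qed

lemma infinite_preorbit_funpow:
  assumes "infinite_preorbit X f x h"
  shows "(f ^^ j) (h (n + j)) = h n"
proof (induction j)
  case (Suc j)
  have "f (h (n + Suc j)) = h (n + j)"
    using assms by (simp add: infinite_preorbit_def)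
  then show ?case using Suc by (simp add: funpow_swap1)
qed simp

section \<open>Ergodicity versus surjectivity and comparability\<close>

lemma ergodic_imp_chain:
  assumes f: "f \<in> X \<rightarrow> X" and erg: "topologically_ergodic (primal_topology X f) f"
  shows "f ` X = X" "\<forall>x\<in>X. \<forall>y\<in>X. (\<exists>k. (f ^^ k) x = y) \<or> (\<exists>k. (f ^^ k) y = x)"
proof -
  have common: "\<exists>u\<in>X. \<exists>a b. b \<ge> 1 \<and> (f ^^ a) u = x \<and> (f ^^ b) u = y" if "x \<in> X" "y \<in> X" for x y
  proof -
    let ?V = "\<lambda>x. {y \<in> X. \<exists>k. (f ^^ k) y = x}"
    have "x \<in> ?V x" "y \<in> ?V y" using that by (auto intro: exI[of _ 0])
    then have "infinite {k. (f ^^ k) ` ?V x \<inter> ?V y \<noteq> {}}" (is "infinite ?D")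
      using erg openin_primal_topology_backward[OF f] that
      unfolding topologically_ergodic_def by blast
    then have "\<forall>m. \<exists>k>m. k \<in> ?D" by (rule infinite_nat_iff_unbounded[THEN iffD1])
    \<comment> \<open>A positive transition time makes \<open>b = c + k\<close> positive, which
      surjectivity needs below.\<close>
    then obtain k where "k > 0" "k \<in> ?D" by meson
    then obtain u a c where "u \<in> X" "(f ^^ a) u = x" "(f ^^ c) ((f ^^ k) u) = y" by auto
    with \<open>k > 0\<close> show ?thesis
      by (intro bexI[of _ u] exI[of _ a] exI[of _ "c + k"]) (auto simp: funpow_add)
  qed
  show "f ` X = X"
  proof
    show "X \<subseteq> f ` X"
    proof
      fix x assume "x \<in> X"
      then obtain u b where u: "u \<in> X" "b \<ge> 1" "(f ^^ b) u = x" using common by blast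
      then have "x = f ((f ^^ (b - 1)) u)" by (cases b) auto
      then show "x \<in> f ` X" using funpow_mem[OF f u(1)] by blast
    qed
  qed (use f in auto)
  show "\<forall>x\<in>X. \<forall>y\<in>X. (\<exists>k. (f ^^ k) x = y) \<or> (\<exists>k. (f ^^ k) y = x)"
  proof (intro ballI)
    fix x y assume "x \<in> X" "y \<in> X"
    then obtain u a b where u: "(f ^^ a) u = x" "(f ^^ b) u = y" using common by blast
    then show "(\<exists>k. (f ^^ k) x = y) \<or> (\<exists>k. (f ^^ k) y = x)"
      by (rule funpow_orbit_chain)
  qed
qed

lemma chain_imp_ergodic:
  assumes f: "f \<in> X \<rightarrow> X" and surj: "f ` X = X"
    and chain: "\<forall>x\<in>X. \<forall>y\<in>X. (\<exists>k. (f ^^ k) x = y) \<or> (\<exists>k. (f ^^ k) y = x)"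
  shows "topologically_ergodic (primal_topology X f) f"
  unfolding topologically_ergodic_def
proof (intro allI impI, elim conjE)
  fix U V
  assume U: "openin (primal_topology X f) U" "U \<noteq> {}" and V: "openin (primal_topology X f) V" "V \<noteq> {}"
  then obtain x y where xy: "x \<in> U" "y \<in> V" by blast
  then have X: "x \<in> X" "y \<in> X" using U V by (auto simp: openin_primal_topology)
  \<comment> \<open>The witness is the entry at index \<open>n\<close> of an infinite preorbit of
    \<open>z\<close>.\<close>
  have preimage: "\<exists>u\<in>X. (f ^^ n) u = z" if z: "z \<in> X" for z n
  proof -
    obtain h where h: "infinite_preorbit X f z h"
      using infinite_preorbit_exists[OF surj z] by blast
    then have "h n \<in> X" "h 0 = z" by (auto simp: infinite_preorbit_def)
    with infinite_preorbit_funpow[OF h, of n 0] show ?thesis by (intro bexI[of _ "h n"]) auto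
  qed
  have "\<exists>k\<ge>n. (f ^^ k) ` U \<inter> V \<noteq> {}" for n
    using chain[rule_format, OF X]
  proof
    assume "\<exists>m. (f ^^ m) x = y"
    then obtain m where m: "(f ^^ m) x = y" by blast
    \<comment> \<open>Going back from \<open>x\<close> stays in the open set \<open>U\<close> and
      delays the arrival at \<open>y\<close> by \<open>n\<close> steps.\<close>
    obtain u where u: "u \<in> X" "(f ^^ n) u = x" using preimage[OF X(1)] by blast
    then have "u \<in> U" using openin_primal_topology_funpow[OF U(1) f] xy by blast
    moreover have "(f ^^ (m + n)) u = y" using m u by (simp add: funpow_add)
    ultimately show ?thesis using xy by (intro exI[of _ "m + n"]) auto
  next
    assume "\<exists>m. (f ^^ m) y = x"
    then obtain m where m: "(f ^^ m) y = x" by blast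
    \<comment> \<open>Here \<open>u\<close> meets \<open>y\<close> at time \<open>n\<close> and
      \<open>x\<close> later; the visit to \<open>x\<close> puts \<open>u\<close> in
      \<open>U\<close>.\<close>
    obtain u where u: "u \<in> X" "(f ^^ n) u = y" using preimage[OF X(2)] by blast
    then have "(f ^^ (m + n)) u \<in> U" using m xy by (simp add: funpow_add)
    then have "u \<in> U" using openin_primal_topology_funpow[OF U(1) f u(1)] by blast
    then show ?thesis using xy u by (intro exI[of _ n]) auto
  qed
  then show "infinite {k. (f ^^ k) ` U \<inter> V \<noteq> {}}"
    by (simp add: infinite_nat_iff_unbounded_le)
qed

section \<open>Covers by an orbit and a preorbit\<close>

lemma preorbit_cover_imp_chain:
  assumes f: "f \<in> X \<rightarrow> X" and h: "infinite_preorbit X f x h"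
    and X: "X = forward_orbit f x \<union> range h"
  shows "f ` X = X" "\<forall>y\<in>X. \<forall>z\<in>X. (\<exists>k. (f ^^ k) y = z) \<or> (\<exists>k. (f ^^ k) z = y)"
proof -
  \<comment> \<open>All late entries of \<open>h\<close> reach \<open>y\<close>, so two points have
    a common starting point; \<open>j \<ge> 1\<close> yields a preimage of \<open>y\<close>.\<close>
  have reach: "\<exists>N. \<forall>n\<ge>N. \<exists>j\<ge>1. (f ^^ j) (h n) = y" if y: "y \<in> X" for y
  proof -
    consider k where "y = (f ^^ k) x" | k where "y = h k"
      using y equalityD1[OF X] unfolding forward_orbit_def by blast
    then show ?thesis
    proof cases
      case 1
      have "(f ^^ (k + n)) (h n) = y" for n
        using infinite_preorbit_funpow[OF h, of n 0] h 1
        by (simp add: funpow_add infinite_preorbit_def)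
      then have "\<exists>j\<ge>1. (f ^^ j) (h n) = y" if "n \<ge> 1" for n
        using that by (intro exI[of _ "k + n"]) simp
      then show ?thesis by blast
    next
      case 2
      have "(f ^^ (n - k)) (h n) = y" if "n \<ge> Suc k" for n
        using infinite_preorbit_funpow[OF h, of "n - k" k] 2 that by simp
      then have "\<exists>j\<ge>1. (f ^^ j) (h n) = y" if "n \<ge> Suc k" for n
        using that by (intro exI[of _ "n - k"]) simp
      then show ?thesis by blast
    qed
  qed
  have hX: "h n \<in> X" for n using h by (auto simp: infinite_preorbit_def)
  show "f ` X = X"
  proof
    show "X \<subseteq> f ` X"
    proof
      fix y assume "y \<in> X"
      then obtain n j where j: "j \<ge> 1" "(f ^^ j) (h n) = y" using reach by blast
      then have "y = f ((f ^^ (j - 1)) (h n))" by (cases j) auto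
      then show "y \<in> f ` X" using funpow_mem[OF f hX] by blast
    qed
  qed (use f in auto)
  show "\<forall>y\<in>X. \<forall>z\<in>X. (\<exists>k. (f ^^ k) y = z) \<or> (\<exists>k. (f ^^ k) z = y)"
  proof (intro ballI)
    fix y z assume "y \<in> X" "z \<in> X"
    then obtain M N where "\<forall>n\<ge>M. \<exists>j\<ge>1. (f ^^ j) (h n) = y" "\<forall>n\<ge>N. \<exists>j\<ge>1. (f ^^ j) (h n) = z"
      using reach by meson
    then obtain a b where u: "(f ^^ a) (h (max M N)) = y" "(f ^^ b) (h (max M N)) = z"
      by (meson max.cobounded1 max.cobounded2)
    then show "(\<exists>k. (f ^^ k) y = z) \<or> (\<exists>k. (f ^^ k) z = y)"
      by (rule funpow_orbit_chain)
  qed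
qed

lemma chain_imp_preorbit_cover:
  assumes "X \<noteq> {}" and f: "f \<in> X \<rightarrow> X" and surj: "f ` X = X"
    and chain: "\<forall>x\<in>X. \<forall>y\<in>X. (\<exists>k. (f ^^ k) x = y) \<or> (\<exists>k. (f ^^ k) y = x)"
  shows "\<exists>x\<in>X. \<exists>h. infinite_preorbit X f x h \<and> X = forward_orbit f x \<union> range h"
proof -
  \<comment> \<open>By comparability, only the points that reach \<open>x\<close> remain to be
    covered.\<close>
  have cover: "X = forward_orbit f x \<union> range h"
    if "x \<in> X" "infinite_preorbit X f x h"
      and "\<And>y k. y \<in> X \<Longrightarrow> (f ^^ k) y = x \<Longrightarrow> y \<in> forward_orbit f x \<union> range h" for x h
  proof
    show "X \<subseteq> forward_orbit f x \<union> range h"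
    proof
      fix y assume y: "y \<in> X"
      then consider k where "(f ^^ k) x = y" | k where "(f ^^ k) y = x"
        using chain \<open>x \<in> X\<close> by blast
      then show "y \<in> forward_orbit f x \<union> range h"
        using that(3)[OF y] by cases (auto simp: forward_orbit_def)
    qed
    show "forward_orbit f x \<union> range h \<subseteq> X"
      using that(1,2) funpow_mem[OF f] by (auto simp: forward_orbit_def infinite_preorbit_def)
  qed
  show ?thesis
  proof (cases "\<forall>x\<in>X. \<exists>m>0. (f ^^ m) x = x")
    case True
    obtain x where x: "x \<in> X" using assms(1) by blast
    obtain h where h: "infinite_preorbit X f x h"
      using infinite_preorbit_exists[OF surj x] by blast
    have "y \<in> forward_orbit f x" if y: "y \<in> X" "(f ^^ k) y = x" for y k
    proof -
      obtain m where m: "m > 0" "(f ^^ m) y = y" using True y by blast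
      have "(f ^^ (m * k)) y = y"
        by (induction k) (use m in \<open>simp_all add: funpow_add\<close>)
      \<comment> \<open>As \<open>m > 0\<close>, the return time \<open>m * k\<close> is at least
        \<open>k\<close>: after \<open>k\<close> steps \<open>y\<close> is at \<open>x\<close>, and
        the remaining steps lead back to \<open>y\<close>.\<close>
      moreover have "m * k - k + k = m * k" using m by simp
      ultimately have "(f ^^ (m * k - k)) x = y"
        using y(2) by (metis comp_apply funpow_add)
      then show ?thesis by (auto simp: forward_orbit_def)
    qed
    then show ?thesis using cover[OF x h] x h by blast
  next
    case False
    then obtain x where x: "x \<in> X" and "\<forall>m>0. (f ^^ m) x \<noteq> x" by blast
    then have aper: "m = 0" if "(f ^^ m) x = x" for m
      using that by (cases "m = 0") auto
    obtain h where h: "infinite_preorbit X f x h"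
      using infinite_preorbit_exists[OF surj x] by blast
    \<comment> \<open>Iterates commute, so \<open>m\<close> steps from \<open>x\<close> end at
      \<open>(f ^^ k) z = x\<close>; aperiodicity forces \<open>m = 0\<close>.\<close>
    have eq: "y = z" if "(f ^^ k) y = x" "(f ^^ k) z = x" "(f ^^ m) y = z" for y z k m
    proof -
      have "(f ^^ m) x = (f ^^ (m + k)) y" using that by (simp add: funpow_add)
      also have "\<dots> = (f ^^ (k + m)) y" by (simp add: add.commute)
      also have "\<dots> = x" using that by (simp add: funpow_add)
      finally have "m = 0" by (rule aper)
      with that show ?thesis by simp
    qed
    have "y \<in> range h" if y: "y \<in> X" "(f ^^ k) y = x" for y k
    proof -
      have hk: "(f ^^ k) (h k) = x" "h k \<in> X"
        using infinite_preorbit_funpow[OF h, of k 0] h by (auto simp: infinite_preorbit_def)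
      have "y = h k"
        \<comment> \<open>Either of \<open>y\<close> and \<open>h k\<close> may be the one that
          reaches the other, hence both orders of \<open>eq\<close>.\<close>
        using chain[rule_format, OF y(1) hk(2)] eq[OF y(2) hk(1)] eq[OF hk(1) y(2)] by metis
      then show ?thesis by blast
    qed
    then show ?thesis using cover[OF x h] x h by blast
  qed
qed

theorem theorem14:
  fixes X :: "'a set" and f :: "'a \<Rightarrow> 'a"
  assumes "X \<noteq> {}" and "f \<in> X \<rightarrow> X"
  defines "V \<equiv> smallest_open (primal_topology X f)"
  shows
    "(topologically_ergodic (primal_topology X f) f
        \<longleftrightarrow> (f ` X = X \<and> (\<forall>x\<in>X. \<forall>y\<in>X. V x \<subseteq> V y \<or> V y \<subseteq> V x)))
     \<and> ((f ` X = X \<and> (\<forall>x\<in>X. \<forall>y\<in>X. V x \<subseteq> V y \<or> V y \<subseteq> V x))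
        \<longleftrightarrow> (\<exists>x\<in>X. \<exists>h. infinite_preorbit X f x h \<and> X = forward_orbit f x \<union> range h))"
proof -
  have chain: "(\<forall>x\<in>X. \<forall>y\<in>X. V x \<subseteq> V y \<or> V y \<subseteq> V x)
    \<longleftrightarrow> (\<forall>x\<in>X. \<forall>y\<in>X. (\<exists>k. (f ^^ k) x = y) \<or> (\<exists>k. (f ^^ k) y = x))"
    using smallest_open_subset_iff[OF assms(2)] by (simp add: V_def)
  show ?thesis
    unfolding chain
  proof (intro conjI iffI; (elim conjE bexE exE)?)
    assume "topologically_ergodic (primal_topology X f) f"
    note ergodic_imp_chain[OF assms(2) this]
    then show "f ` X = X" "\<forall>x\<in>X. \<forall>y\<in>X. (\<exists>k. (f ^^ k) x = y) \<or> (\<exists>k. (f ^^ k) y = x)" .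
  next
    fix x h
    assume "infinite_preorbit X f x h" "X = forward_orbit f x \<union> range h"
    note preorbit_cover_imp_chain[OF assms(2) this]
    then show "f ` X = X" "\<forall>x\<in>X. \<forall>y\<in>X. (\<exists>k. (f ^^ k) x = y) \<or> (\<exists>k. (f ^^ k) y = x)" .
  qed (fact chain_imp_ergodic[OF assms(2)] chain_imp_preorbit_cover[OF assms(1,2)])+
qed

end
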